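(* Let $q$ be even and let $m,k$ be positive integers with $m>(k+1)/2$. Then an ${\rm Sp}(4mk-2,q)$-space has a maximal symplectic partial spread of size $q^{2mk-k}+1$.
   Context: An ${\rm Sp}(2n,q)$-space is a $2n$-dimensional $\mathbb{F}_q$-space with a nondegenerate alternating form. A symplectic partial spread is a set of totally isotropic $n$-dimensional subspaces pairwise meeting only in $0$; it is maximal if not properly contained in another symplectic partial spread. *)

theory Defs
  imports Complex_Main
begin

text \<open>
  The form is written as a two-argument function, linear in each argument. The number $q$ does
  not appear here: it is the cardinality of the scalar type. That the dimension is even
  is a consequence of the assumptions and is not required separately.
\<close>

locale symplectic_space = vector_space scale
  for scale :: "'a::field \<Rightarrow> 'b::ab_group_add \<Rightarrow> 'b" +
  fixes form :: "'b \<Rightarrow> 'b \<Rightarrow> 'a"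
  assumes finite_dim: "\<exists>B. finite B \<and> span B = UNIV"
    and form_linear_left: "Vector_Spaces.linear scale (*) (\<lambda>x. form x y)"
    and form_linear_right: "Vector_Spaces.linear scale (*) (\<lambda>y. form x y)"
    and form_alternating: "form x x = 0"
    and form_nondegenerate: "(\<And>y. form x y = 0) \<Longrightarrow> x = 0"
begin

definition totally_isotropic :: "'b set \<Rightarrow> bool" where
  "totally_isotropic W \<longleftrightarrow> (\<forall>x\<in>W. \<forall>y\<in>W. form x y = 0)"

text \<open>The second conjunct says that members have dimension $n$ in a space of dimension $2n$.\<close>

definition symplectic_partial_spread :: "'b set set \<Rightarrow> bool" where
  "symplectic_partial_spread S \<longleftrightarrow>
     (\<forall>W\<in>S. subspace W \<and> 2 * dim W = dim UNIV \<and> totally_isotropic W) \<and>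
     (\<forall>U\<in>S. \<forall>W\<in>S. U \<noteq> W \<longrightarrow> U \<inter> W = {0})"

definition maximal_symplectic_partial_spread :: "'b set set \<Rightarrow> bool" where
  "maximal_symplectic_partial_spread S \<longleftrightarrow>
     symplectic_partial_spread S \<and> \<not> (\<exists>T. symplectic_partial_spread T \<and> S \<subset> T)"

end

end

theory Submission
  imports Defs "HOL-Algebra.Algebraic_Closure_Type" "HOL-Library.Z2" "HOL-Library.Product_Plus"
begin

text \<open>
  Let $F$ be the field of order $q$, let $F \subseteq K \subseteq L$ with $[K:F] = k$ and $[L:K] = 2m-1$, and let
  $T$ be the trace from $L$ to $K$. The quadratic form $T(xy) + ab$ on $L \oplus K \oplus L \oplus K$
  has an orthogonal spread of size $q^{k(2m-1)} + 1$ over $K$, obtained from the Desarguesian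
  symplectic spread. Follow this form by an $F$-linear functional $\lambda$ on $K$, and project from
  a nonsingular point: the result is a partial spread of the same size in a symplectic $F$-space of
  dimension $4mk-2$. It is maximal because a further member $W$ would contain no nonzero vector that
  is singular over $K$. However, as $m > (k+1)/2$, one can choose $k+1$ linearly independent vectors
  of $W$ one after the other that are pairwise orthogonal for the $K$-valued polar form; on their span
  the quadratic form is additive with values in $K$, hence not injective by cardinality, which yields
  a singular vector.
\<close>

section \<open>Finite fields and vector spaces\<close>

lemma (in vector_space) card_span:
  assumes UN: "finite (UNIV :: 'a set)" and B: "finite B" "independent B"
  shows "finite (span B) \<and> card (span B) = card (UNIV :: 'a set) ^ card B"
  using B
proof (induction B rule: finite_induct)
  case empty
  then show ?case by simp
next
  case (insert b B)
  have ind: "independent B" and nb: "b \<notin> span B"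
    using insert.prems insert.hyps by (auto simp: independent_insert)
  note IH = insert.IH[OF ind]
  let ?f = "\<lambda>(c, v). c *s b + v"
  have inj: "inj_on ?f (UNIV \<times> span B)"
  proof (rule inj_onI, clarsimp)
    fix c v d w
    assume v: "v \<in> span B" "w \<in> span B" and e: "c *s b + v = d *s b + w"
    have "(c - d) *s b = w - v"
      using e by (simp add: algebra_simps scale_left_diff_distrib)
    then have mem: "(c - d) *s b \<in> span B"
      using v by (simp add: span_diff)
    have "c = d"
    proof (rule ccontr)
      assume "c \<noteq> d"
      then have "b = inverse (c - d) *s ((c - d) *s b)" by simp
      then show False using span_scale[OF mem] nb by metis
    qed
    then show "c = d \<and> v = w" using e by simp
  qed
  have im: "?f ` (UNIV \<times> span B) = span (insert b B)"
  proof (intro equalityI subsetI)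
    fix x assume "x \<in> ?f ` (UNIV \<times> span B)"
    then show "x \<in> span (insert b B)"
      by (auto intro!: span_add span_scale intro: span_base span_mono[THEN subsetD, of B "insert b B"])
  next
    fix x assume "x \<in> span (insert b B)"
    then obtain c where "x - c *s b \<in> span B"
      by (auto simp: span_insert)
    then have "(c, x - c *s b) \<in> UNIV \<times> span B" by simp
    moreover have "x = ?f (c, x - c *s b)" by simp
    ultimately show "x \<in> ?f ` (UNIV \<times> span B)" by (rule rev_image_eqI)
  qed
  have "card (span (insert b B)) = card (UNIV :: 'a set) * card (span B)"
    unfolding im[symmetric] by (simp add: card_image[OF inj] card_cartesian_product)
  moreover have "finite (span (insert b B))"
    unfolding im[symmetric] using UN IH by auto
  ultimately show ?case using IH insert.hyps by simp
qed

lemma (in vector_space) card_subspace: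
  assumes UN: "finite (UNIV :: 'a set)" and W: "subspace W" "W \<subseteq> span C" "finite C"
  shows "finite W" "card W = card (UNIV :: 'a set) ^ dim W"
proof -
  obtain B where B: "B \<subseteq> W" "independent B" "W \<subseteq> span B" "card B = dim W"
    by (rule basis_exists)
  have fB: "finite B"
    using independent_span_bound[of C B] W B by blast
  have "span B = W"
    using B W by (meson span_minimal subset_antisym)
  with card_span[OF UN fB B(2)] B(4) show "finite W" "card W = card (UNIV :: 'a set) ^ dim W"
    by auto
qed

text \<open>A group of exponent two is a vector space over the field of two elements. Applied to the
  base field, this makes \<open>q\<close> a power of two, so that taking \<open>q\<close>-th powers
  is additive.\<close>

lemma card_power_of_2:
  assumes fin: "finite (UNIV :: 'a::ab_group_add set)" and two: "\<And>x::'a. x + x = 0"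
  shows "\<exists>r. card (UNIV :: 'a set) = 2 ^ r"
proof -
  define s where "s = (\<lambda>(c::bit) (x::'a). if c = 0 then 0 else x)"
  have s0: "s 0 x = 0" and s1: "s 1 x = x" for x
    by (simp_all add: s_def)
  have s: "s (a + b) x = s a x + s b x" "s a (s b x) = s (a * b) x" "s a (x + y) = s a x + s a y"
    for a b :: bit and x y :: 'a
    by (cases a; cases b; simp only: s0 s1 two add_0 add_0_right one_add_one bit_2_eq_0 mult_1 mult_zero_left mult_zero_right)+
  interpret vector_space s
    by standard (simp_all only: s s1)
  have U: "(UNIV :: bit set) = {0, 1}"
  proof (rule UNIV_eq_I)
    show "x \<in> {0, 1}" for x :: bit by (cases x) simp_all
  qed
  have "card (UNIV :: 'a set) = card (UNIV :: bit set) ^ dim (UNIV :: 'a set)"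
    by (rule card_subspace(2)[where C = UNIV]) (auto simp: fin U span_superset)
  moreover have "card (UNIV :: bit set) = 2" by (simp add: U)
  ultimately show ?thesis by metis
qed

text \<open>Multiplication by a nonzero \<open>x\<close> permutes the nonzero elements; compare
  their product before and after.\<close>

lemma finite_field_power_card:
  fixes x :: "'a::{field,finite}"
  shows "x ^ card (UNIV :: 'a set) = x"
proof (cases "x = 0")
  case True
  then show ?thesis by (simp add: finite_UNIV_card_ge_0)
next
  case False
  let ?U = "UNIV - {0::'a}"
  have "(\<lambda>y. x * y) ` ?U = ?U"
    using False by (intro endo_inj_surj) (auto simp: inj_on_def)
  then have "prod (\<lambda>y. y) ?U = prod (\<lambda>y. y) ((\<lambda>y. x * y) ` ?U)" by simp
  also have "\<dots> = prod (\<lambda>y. x * y) ?U"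
    using False by (subst prod.reindex) (auto simp: inj_on_def)
  also have "\<dots> = x ^ card ?U * prod (\<lambda>y. y) ?U"
    by (simp add: prod.distrib)
  finally have "x ^ card ?U = 1" by simp
  moreover have "card (UNIV :: 'a set) = Suc (card ?U)"
    by (subst card.remove[of _ 0]) auto
  ultimately show ?thesis by (simp only: power_Suc mult_1_right)
qed

text \<open>The preceding identity is evaluated at -1, where an even exponent gives 1.\<close>

lemma even_card_imp_two_eq_zero:
  assumes "even (card (UNIV :: 'a::{field,finite} set))"
  shows "(2::'a) = 0"
proof -
  have "(-1::'a) = (-1) ^ card (UNIV :: 'a set)"
    by (rule finite_field_power_card[symmetric])
  also have "\<dots> = 1" using assms by simp
  finally show ?thesis
    by (metis add.left_inverse one_add_one)
qed

text \<open>Separability: in characteristic two the derivative of \<open>X^N - X\<close> is the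
  constant -1, so the linear factors are distinct. This later gives the orders of \<open>K\<close>
  and \<open>L\<close>.\<close>

lemma card_roots_X_power_diff_X:
  assumes ch: "CHAR('a::alg_closed_field) = 2" and N: "N = 2 ^ r" "r > 0"
  shows "card {z::'a. z ^ N = z} = N"
proof -
  define p :: "'a poly" where "p = monom 1 N - monom 1 1"
  have N2: "N \<ge> 2" using N by (cases r) auto
  have deg: "degree p = N" "lead_coeff p = 1"
  proof -
    have "degree (monom 1 N + - monom 1 1 :: 'a poly) = N"
      using N2 by (subst degree_add_eq_left) (auto simp: degree_monom_eq)
    then have "degree p = N" by (simp add: p_def)
    then show "degree p = N" "lead_coeff p = 1" using N2 by (auto simp: p_def)
  qed
  have p0: "p \<noteq> 0" using deg N2 by auto
  have "of_nat N = (0::'a)"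
    unfolding of_nat_eq_0_iff_char_dvd using N ch by simp
  then have pd: "pderiv p = [:-1:]"
    by (simp add: p_def pderiv_diff pderiv_monom one_pCons)
  obtain A where A: "size A = degree p" "p = smult (lead_coeff p) (\<Prod>x\<in>#A. [:-x, 1:])"
    using alg_closed_imp_factorization[OF p0] by blast
  have pA: "p = (\<Prod>x\<in>#A. [:-x, 1:])" using A deg by simp
  \<comment> \<open>A root of multiplicity at least two would also be a root of the
    derivative.\<close>
  have c1: "count A x = 1" if x: "x \<in># A" for x
  proof (rule ccontr)
    assume "count A x \<noteq> 1"
    obtain C where C: "A = add_mset x C"
      using x by (meson multi_member_split)
    with \<open>count A x \<noteq> 1\<close> have "x \<in># C"
      by (simp add: not_in_iff)
    then obtain D where "C = add_mset x D"
      by (meson multi_member_split)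
    then have "p = [:-x, 1:] * ([:-x, 1:] * (\<Prod>x\<in>#D. [:-x, 1:]))"
      using pA C by simp
    then have "poly (pderiv p) x = 0" 
      by (simp add: pderiv_mult del: mult_pCons_left)
    then show False by (simp add: pd)
  qed
  have "{z::'a. z ^ N = z} = set_mset A"
  proof -
    have "z ^ N = z \<longleftrightarrow> poly p z = 0" for z
      by (simp add: p_def poly_monom)
    moreover have "poly p z = 0 \<longleftrightarrow> z \<in># A" for z
      unfolding pA by (auto simp: poly_prod_mset prod_mset_zero_iff)
    ultimately show ?thesis by auto
  qed
  moreover have "size A = card (set_mset A)"
    unfolding size_multiset_overloaded_eq using c1 by simp
  ultimately show ?thesis using A deg by simp
qed

section \<open>Isometries of symplectic spaces\<close>

text \<open>The space is a subset \<open>W\<close> of the type, since the model below is a finite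
  set inside an infinite field's fourth power. Bilinearity is assumed on the whole type,
  nondegeneracy within \<open>W\<close>.\<close>

locale alternating_subspace = vector_space scale
  for scale :: "'a::field \<Rightarrow> 'b::ab_group_add \<Rightarrow> 'b" (infixr "*s" 75) +
  fixes form :: "'b \<Rightarrow> 'b \<Rightarrow> 'a" and W :: "'b set"
  assumes subspace_W: "subspace W" and finite_W: "finite W"
    and form_add_left: "form (x + y) z = form x z + form y z"
    and form_add_right: "form x (y + z) = form x y + form x z"
    and form_scale_left: "form (c *s x) y = c * form x y"
    and form_scale_right: "form x (c *s y) = c * form x y"
    and form_self: "form x x = 0"
    and nondegenerate: "x \<in> W \<Longrightarrow> (\<And>y. y \<in> W \<Longrightarrow> form x y = 0) \<Longrightarrow> x = 0"
begin

lemma form_zero [simp]: "form 0 y = 0" "form x 0 = 0"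
  using form_scale_left[of 0 0 y] form_scale_right[of x 0 0] by simp_all

lemma form_diff_left: "form (x - y) z = form x z - form y z"
  using form_add_left[of "x - y" y z] by simp

lemma form_diff_right: "form x (y - z) = form x y - form x z"
  using form_add_right[of x "y - z" z] by simp

lemma form_skew: "form y x = - form x y"
proof -
  have "form (x + y) (x + y) = form y x + form x y"
    unfolding form_add_left form_add_right by (simp add: form_self)
  then have "form y x + form x y = 0" by (simp only: form_self)
  then show ?thesis by (simp add: eq_neg_iff_add_eq_0)
qed

lemma form_sum_left: "form (sum g I) y = (\<Sum>i\<in>I. form (g i) y)"
  by (induction I rule: infinite_finite_induct) (simp_all add: form_add_left)

lemma form_sum_right: "form x (sum g I) = (\<Sum>i\<in>I. form x (g i))"
  by (induction I rule: infinite_finite_induct) (simp_all add: form_add_right)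

text \<open>Only the values below \<open>n\<close> matter: a shorter family keeps the same
  functions, and a longer one arises by function update.\<close>

definition hyperbolic :: "nat \<Rightarrow> (nat \<Rightarrow> 'b) \<Rightarrow> (nat \<Rightarrow> 'b) \<Rightarrow> bool" where
  "hyperbolic n e f \<longleftrightarrow>
     (\<forall>i<n. e i \<in> W \<and> f i \<in> W) \<and>
     (\<forall>i<n. \<forall>j<n. form (e i) (e j) = 0 \<and> form (f i) (f j) = 0 \<and>
        form (e i) (f j) = (if i = j then 1 else 0))"

definition comb :: "nat \<Rightarrow> (nat \<Rightarrow> 'b) \<Rightarrow> (nat \<Rightarrow> 'b) \<Rightarrow> (nat \<Rightarrow> 'a) \<Rightarrow> (nat \<Rightarrow> 'a) \<Rightarrow> 'b" where
  "comb n e f a b = (\<Sum>i<n. a i *s e i + b i *s f i)"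

lemma comb_in_W: "hyperbolic n e f \<Longrightarrow> comb n e f a b \<in> W"
  unfolding comb_def hyperbolic_def
  by (intro subspace_sum subspace_add subspace_scale subspace_W) auto

lemma form_e_comb: "hyperbolic n e f \<Longrightarrow> j < n \<Longrightarrow> form (e j) (comb n e f a b) = b j"
  unfolding comb_def form_sum_right form_add_right form_scale_right hyperbolic_def
  by (subst sum.cong[OF refl, where h = "\<lambda>i. if i = j then b i else 0"]) auto

lemma form_f_comb: "hyperbolic n e f \<Longrightarrow> j < n \<Longrightarrow> form (f j) (comb n e f a b) = - a j"
  unfolding comb_def form_sum_right form_add_right form_scale_right hyperbolic_def
  by (subst sum.cong[OF refl, where h = "\<lambda>i. if i = j then - a i else 0"])
     (auto simp: form_skew[of "f j" "e _"])

lemma form_comb_comb: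
  assumes "hyperbolic n e f"
  shows "form (comb n e f a b) (comb n e f c d) = (\<Sum>i<n. a i * d i - b i * c i)"
proof -
  have "form (comb n e f a b) (comb n e f c d) =
      (\<Sum>i<n. a i * form (e i) (comb n e f c d) + b i * form (f i) (comb n e f c d))"
    by (subst comb_def) (simp add: form_sum_left form_add_left form_scale_left)
  also have "\<dots> = (\<Sum>i<n. a i * d i - b i * c i)"
    using assms by (intro sum.cong) (simp_all add: form_e_comb form_f_comb)
  finally show ?thesis .
qed

lemma hyperbolic_length_le: "hyperbolic n e f \<Longrightarrow> n \<le> card W"
proof -
  assume h: "hyperbolic n e f"
  have "inj_on e {..<n}"
    using h unfolding hyperbolic_def inj_on_def by (metis lessThan_iff zero_neq_one)
  then have "card (e ` {..<n}) = n" by (simp add: card_image)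
  moreover have "e ` {..<n} \<subseteq> W" using h by (auto simp: hyperbolic_def)
  ultimately show ?thesis using card_mono[OF finite_W] by metis
qed

text \<open>Gram-Schmidt for hyperbolic pairs: the remainder of \<open>w\<close> after removing its
  components along the pairs is nonzero and orthogonal to all of them. By nondegeneracy it pairs
  nontrivially with some \<open>v\<close> in \<open>W\<close>, and the rescaled remainder of
  \<open>v\<close> is its partner.\<close>

lemma hyperbolic_extend:
  assumes h: "hyperbolic n e f" and w: "w \<in> W"
    and ne: "w \<noteq> comb n e f (\<lambda>i. form w (f i)) (\<lambda>i. form (e i) w)"
  shows "\<exists>e' f'. hyperbolic (Suc n) e' f'"
proof -
  define P where "P v = v - comb n e f (\<lambda>i. form v (f i)) (\<lambda>i. form (e i) v)" for v
  have PW: "P v \<in> W" if "v \<in> W" for v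
    using that unfolding P_def by (intro subspace_diff subspace_W comb_in_W h)
  have eP: "form (e i) (P v) = 0" "form (f i) (P v) = 0" if "i < n" for i v
    using that h form_skew[of "f i" v]
    by (simp_all add: P_def form_diff_right form_e_comb form_f_comb)
  have Pe: "form (P v) (e i) = 0" "form (P v) (f i) = 0" if "i < n" for i v
    using eP[OF that] form_skew[of "P v"] by simp_all
  have "P w \<noteq> 0" using ne by (simp add: P_def)
  then obtain v where v: "v \<in> W" "form (P w) v \<noteq> 0"
    using nondegenerate[OF PW[OF w]] by blast
  \<comment> \<open>\<open>P v\<close> differs from \<open>v\<close> by a combination of the pairs,
    to which \<open>P w\<close> is orthogonal.\<close>
  have "form (P w) (P v) = form (P w) v"
    unfolding P_def[of v] form_diff_right
    by (simp add: comb_def form_sum_right form_add_right form_scale_right Pe)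
  with v have nz: "form (P w) (P v) \<noteq> 0" by simp
  define e' where "e' = e(n := P w)"
  define f' where "f' = f(n := inverse (form (P w) (P v)) *s P v)"
  have "hyperbolic (Suc n) e' f'"
    unfolding hyperbolic_def
    using h nz w v(1)
    by (auto simp: e'_def f'_def less_Suc_eq hyperbolic_def form_scale_left form_scale_right
        form_self eP Pe PW subspace_W subspace_scale)
  then show ?thesis by blast
qed

text \<open>A family of maximal length works; lengths are bounded because the \<open>e i\<close> are
  distinct elements of the finite set \<open>W\<close>.\<close>

lemma exists_hyperbolic_basis:
  "\<exists>n e f. hyperbolic n e f \<and>
     (\<forall>w\<in>W. w = comb n e f (\<lambda>i. form w (f i)) (\<lambda>i. form (e i) w))"
proof -
  let ?N = "{n. \<exists>e f. hyperbolic n e f}"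
  have fin: "finite ?N"
    by (rule finite_subset[of _ "{..card W}"]) (auto dest: hyperbolic_length_le)
  have "0 \<in> ?N" by (simp add: hyperbolic_def)
  then have "Max ?N \<in> ?N" using fin Max_in by blast
  then obtain e f where h: "hyperbolic (Max ?N) e f" by blast
  have "Suc (Max ?N) \<notin> ?N" using Max_ge[OF fin] Suc_n_not_le_n by blast
  then show ?thesis using h hyperbolic_extend[OF h] by blast
qed

end

text \<open>Coordinates with respect to the basis of \<open>W1\<close> are copied to the first
  \<open>n\<close> pairs of \<open>W2\<close>. Surjectivity comes from equal cardinality rather than
  from a basis of \<open>W2\<close>.\<close>

lemma isometry_into:
  assumes V1: "alternating_subspace s1 form1 W1" and V2: "alternating_subspace s2 form2 W2"
    and h1: "alternating_subspace.hyperbolic form1 W1 n e f"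
    and b1: "\<And>w. w \<in> W1 \<Longrightarrow>
      w = alternating_subspace.comb s1 n e f (\<lambda>i. form1 w (f i)) (\<lambda>i. form1 (e i) w)"
    and h2: "alternating_subspace.hyperbolic form2 W2 n' e' f'"
    and le: "n \<le> n'" and card: "card W1 = card W2"
  shows "\<exists>\<phi>. bij_betw \<phi> W1 W2 \<and> (\<forall>x y. \<phi> (x + y) = \<phi> x + \<phi> y) \<and>
    (\<forall>c x. \<phi> (s1 c x) = s2 c (\<phi> x)) \<and> (\<forall>x\<in>W1. \<forall>y\<in>W1. form2 (\<phi> x) (\<phi> y) = form1 x y)"
proof -
  interpret V1: alternating_subspace s1 form1 W1 by fact
  interpret V2: alternating_subspace s2 form2 W2 by fact
  have h2': "V2.hyperbolic n e' f'"
    using h2 le by (auto simp: V2.hyperbolic_def)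
  define \<phi> where "\<phi> w = V2.comb n e' f' (\<lambda>i. form1 w (f i)) (\<lambda>i. form1 (e i) w)" for w
  have add: "\<phi> (x + y) = \<phi> x + \<phi> y" for x y
    by (simp add: \<phi>_def V2.comb_def V1.form_add_left V1.form_add_right V2.scale_left_distrib
        sum.distrib add_ac)
  have scale: "\<phi> (s1 c x) = s2 c (\<phi> x)" for c x
    by (simp add: \<phi>_def V2.comb_def V1.form_scale_left V1.form_scale_right V2.scale_sum_right
        V2.scale_right_distrib)
  have iso: "form2 (\<phi> x) (\<phi> y) = form1 x y" if "x \<in> W1" "y \<in> W1" for x y
  proof -
    have "form1 x y = (\<Sum>i<n. form1 x (f i) * form1 (e i) y - form1 (e i) x * form1 y (f i))"
      by (subst b1[OF that(1)], subst b1[OF that(2)]) (rule V1.form_comb_comb[OF h1])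
    also have "\<dots> = form2 (\<phi> x) (\<phi> y)"
      unfolding \<phi>_def by (rule V2.form_comb_comb[OF h2', symmetric])
    finally show ?thesis by simp
  qed
  \<comment> \<open>Vectors with equal image pair equally with all of \<open>W1\<close>, so their
    difference lies in the radical.\<close>
  have inj: "inj_on \<phi> W1"
  proof (rule inj_onI)
    fix x y assume xy: "x \<in> W1" "y \<in> W1" "\<phi> x = \<phi> y"
    have "x - y = 0"
    proof (rule V1.nondegenerate)
      show "x - y \<in> W1" using xy by (simp add: V1.subspace_diff V1.subspace_W)
      show "form1 (x - y) z = 0" if "z \<in> W1" for z
        using iso[OF xy(1) that] iso[OF xy(2) that] xy(3) by (simp add: V1.form_diff_left)
    qed
    then show "x = y" by simp
  qed
  have "\<phi> ` W1 \<subseteq> W2"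
    using V2.comb_in_W[OF h2'] by (auto simp: \<phi>_def)
  then have "\<phi> ` W1 = W2"
    using card card_image[OF inj] V2.finite_W by (intro card_subset_eq) auto
  with inj have "bij_betw \<phi> W1 W2" by (simp add: bij_betw_def)
  with add scale iso show ?thesis by blast
qed

text \<open>The space with the shorter basis is mapped to the other one, and the bijection is
  inverted if it goes the wrong way. The inverse is linear only on \<open>W1\<close>, hence the
  bounded quantifiers.\<close>

lemma isometry_exists:
  assumes V1: "alternating_subspace s1 form1 W1" and V2: "alternating_subspace s2 form2 W2"
    and card: "card W1 = card W2"
  shows "\<exists>\<phi>. bij_betw \<phi> W1 W2 \<and> (\<forall>x\<in>W1. \<forall>y\<in>W1. \<phi> (x + y) = \<phi> x + \<phi> y) \<and>
    (\<forall>c. \<forall>x\<in>W1. \<phi> (s1 c x) = s2 c (\<phi> x)) \<and>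
    (\<forall>x\<in>W1. \<forall>y\<in>W1. form2 (\<phi> x) (\<phi> y) = form1 x y)"
proof -
  interpret V1: alternating_subspace s1 form1 W1 by fact
  interpret V2: alternating_subspace s2 form2 W2 by fact
  obtain n e f where h1: "V1.hyperbolic n e f"
    "\<And>w. w \<in> W1 \<Longrightarrow> w = V1.comb n e f (\<lambda>i. form1 w (f i)) (\<lambda>i. form1 (e i) w)"
    using V1.exists_hyperbolic_basis by blast
  obtain n' e' f' where h2: "V2.hyperbolic n' e' f'"
    "\<And>w. w \<in> W2 \<Longrightarrow> w = V2.comb n' e' f' (\<lambda>i. form2 w (f' i)) (\<lambda>i. form2 (e' i) w)"
    using V2.exists_hyperbolic_basis by blast
  show ?thesis
  proof (cases "n \<le> n'")
    case True
    from isometry_into[OF V1 V2 h1 h2(1) True card] show ?thesis by blast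
  next
    case False
    then have "n' \<le> n" by simp
    from isometry_into[OF V2 V1 h2 h1(1) this card[symmetric]]
    obtain \<psi> where \<psi>: "bij_betw \<psi> W2 W1" "\<And>x y. \<psi> (x + y) = \<psi> x + \<psi> y"
      "\<And>c x. \<psi> (s2 c x) = s1 c (\<psi> x)"
      "\<And>x y. x \<in> W2 \<Longrightarrow> y \<in> W2 \<Longrightarrow> form1 (\<psi> x) (\<psi> y) = form2 x y"
      by blast
    define \<phi> where "\<phi> = inv_into W2 \<psi>"
    have bij: "bij_betw \<phi> W1 W2" unfolding \<phi>_def using \<psi>(1) by (rule bij_betw_inv_into)
    have \<psi>\<phi>: "\<psi> (\<phi> x) = x" if "x \<in> W1" for x
      using \<psi>(1) that unfolding \<phi>_def by (simp add: bij_betw_inv_into_right)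
    have \<phi>\<psi>: "\<phi> (\<psi> x) = x" if "x \<in> W2" for x
      using \<psi>(1) that unfolding \<phi>_def by (simp add: bij_betw_inv_into_left)
    have mem: "\<phi> x \<in> W2" if "x \<in> W1" for x
      using bij that by (rule bij_betwE[rule_format])
    have "\<phi> (x + y) = \<phi> x + \<phi> y" if "x \<in> W1" "y \<in> W1" for x y
      using \<phi>\<psi>[of "\<phi> x + \<phi> y"] that
      by (simp add: \<psi> \<psi>\<phi> mem V2.subspace_add V2.subspace_W)
    moreover have "\<phi> (s1 c x) = s2 c (\<phi> x)" if "x \<in> W1" for c x
      using \<phi>\<psi>[of "s2 c (\<phi> x)"] that
      by (simp add: \<psi> \<psi>\<phi> mem V2.subspace_scale V2.subspace_W)
    moreover have "form2 (\<phi> x) (\<phi> y) = form1 x y" if "x \<in> W1" "y \<in> W1" for x y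
      using \<psi>(4)[of "\<phi> x" "\<phi> y"] that by (simp add: \<psi>\<phi> mem)
    ultimately show ?thesis using bij by blast
  qed
qed

section \<open>The partial spread\<close>

text \<open>Subtracting a chosen representative \<open>r (h c)\<close> of its fibre moves
  \<open>c\<close> into the kernel, and \<open>h c\<close> remembers the fibre. This will bound how
  much a \<open>K\<close>-valued orthogonality condition shrinks a subspace.\<close>

lemma card_le_card_kernel_times:
  fixes h :: "'b::ab_group_add \<Rightarrow> 'c::ab_group_add"
  assumes fC: "finite C" and fK: "finite K" and diff: "\<And>x y. x \<in> C \<Longrightarrow> y \<in> C \<Longrightarrow> x - y \<in> C"
    and hK: "h ` C \<subseteq> K" and h: "\<And>x y. x \<in> C \<Longrightarrow> y \<in> C \<Longrightarrow> h (x - y) = h x - h y"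
  shows "card C \<le> card {c \<in> C. h c = 0} * card K"
proof -
  define r where "r z = inv_into C h z" for z
  have r: "r (h c) \<in> C" "h (r (h c)) = h c" if "c \<in> C" for c
    using that by (simp_all add: r_def inv_into_into f_inv_into_f)
  let ?g = "\<lambda>c. (c - r (h c), h c)"
  have "inj_on ?g C" by (rule inj_onI) auto
  moreover have "?g ` C \<subseteq> {c \<in> C. h c = 0} \<times> K"
    using r hK by (auto simp: diff h)
  ultimately have "card C \<le> card ({c \<in> C. h c = 0} \<times> K)"
    using fC fK by (intro card_inj_on_le) auto
  then show ?thesis by (simp add: card_cartesian_product)
qed

section \<open>The tower of fields, axiomatically\<close>

text \<open>The fields are subsets of one ambient field, on all of which \<open>T\<close> and
  \<open>lam\<close> are additive. \<open>T_one\<close> reflects that the degree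
  \<open>2 * m - 1\<close> is odd and the characteristic two; \<open>T_square\<close> says that the
  trace commutes with squaring.\<close>

locale field_tower =
  fixes emb :: "'a::{field,finite} \<Rightarrow> 'e::field"
    and L K :: "'e set" and T :: "'e \<Rightarrow> 'e" and lam :: "'e \<Rightarrow> 'a" and q k m :: nat
  assumes two: "(2::'e) = 0"
    and emb_add: "emb (c + d) = emb c + emb d" and emb_mult: "emb (c * d) = emb c * emb d"
    and emb_one: "emb 1 = 1" and emb_in_K: "emb c \<in> K"
    and L_add: "x \<in> L \<Longrightarrow> y \<in> L \<Longrightarrow> x + y \<in> L" and L_mult: "x \<in> L \<Longrightarrow> y \<in> L \<Longrightarrow> x * y \<in> L"
    and L_inverse: "x \<in> L \<Longrightarrow> inverse x \<in> L"
    and K_add: "x \<in> K \<Longrightarrow> y \<in> K \<Longrightarrow> x + y \<in> K" and K_mult: "x \<in> K \<Longrightarrow> y \<in> K \<Longrightarrow> x * y \<in> K"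
    and K_inverse: "x \<in> K \<Longrightarrow> inverse x \<in> K"
    and K_subset_L: "K \<subseteq> L"
    and q_card: "q = card (UNIV :: 'a set)" and k_pos: "k > 0" and m_pos: "m > 0"
    and card_K: "card K = q ^ k" and card_L: "card L = q ^ (k * (2 * m - 1))"
    and T_add: "T (x + y) = T x + T y" and T_mult: "z \<in> K \<Longrightarrow> T (z * x) = z * T x"
    and T_square: "T (x ^ 2) = T x ^ 2" and T_in_K: "x \<in> L \<Longrightarrow> T x \<in> K" and T_one: "T 1 = 1"
    and lam_add: "lam (x + y) = lam x + lam y" and lam_mult: "lam (emb c * x) = c * lam x"
    and lam_one: "lam 1 = 1"
begin

lemma add_self: "(x::'e) + x = 0"
  using two by (metis mult_2 mult_zero_left)

lemma uminus_eq: "- (x::'e) = x"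
  using add_self[of x] by (simp add: add_eq_0_iff)

lemma diff_eq: "(x::'e) - y = x + y"
  using uminus_eq[of y] by (metis diff_conv_add_uminus)

lemma add_eq_zero_iff: "(x::'e) + y = 0 \<longleftrightarrow> x = y"
  using diff_eq[of x y] by (metis eq_iff_diff_eq_0)

lemma emb_zero: "emb 0 = 0" by (metis emb_add add_0 add_cancel_right_right)

lemma emb_eq_iff: "emb c = emb d \<longleftrightarrow> c = d"
proof
  assume e: "emb c = emb d"
  have "emb (c - d) = 0" using emb_add[of "c - d" d] e by simp
  show "c = d"
  proof (rule ccontr)
    assume "c \<noteq> d"
    then have "emb ((c - d) * inverse (c - d)) = 1" by (simp add: emb_one)
    then show False using \<open>emb (c - d) = 0\<close> by (simp only: emb_mult) simp
  qed
qed simp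

lemma base_add_self: "(c::'a) + c = 0"
  by (metis add_self emb_add emb_eq_iff emb_zero)

lemma zero_mem: "0 \<in> K" "0 \<in> L" "1 \<in> K" "1 \<in> L"
  using emb_in_K[of 0] emb_in_K[of 1] K_subset_L by (auto simp: emb_zero emb_one)

lemma K_L: "x \<in> K \<Longrightarrow> x \<in> L" using K_subset_L by blast

lemma q_gt_1: "q > 1"
  unfolding q_card by (metis card_1_singletonE finite less_one linorder_neqE_nat card_0_eq
      UNIV_I UNIV_not_empty singletonD zero_neq_one One_nat_def)

lemma finite_KL: "finite K" "finite L"
  using card_K card_L q_gt_1 by (metis card.infinite not_one_less_zero power_eq_0_iff)+

lemma T_zero: "T 0 = 0" by (metis T_add add_0 add_cancel_right_right)

lemma T_K: "c \<in> K \<Longrightarrow> T c = c" using T_mult[of c 1] by (simp add: T_one)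

lemma lam_zero: "lam 0 = 0" by (metis lam_add add_0 add_cancel_right_right)

lemma lam_emb: "lam (emb c) = c" using lam_mult[of c 1] by (simp add: lam_one)

text \<open>
  The projection from the nonsingular point $(0,1,0,1)$ is identified with $L \oplus K_0 \oplus L \oplus K_0$,
  where $K_0$ is the kernel of $\lambda$ on $K$; the projection sends $(x,a,y,b)$ to
  $(x, \mu(a+b), y, \mu(b))$. The second coordinate is $a+b$ rather than $a$, so $ab$ becomes $b^2 + ab$;
  the members of the spread become graphs over the first two coordinates and one exceptional member.
\<close>

definition K0 :: "'e set" where "K0 = {a \<in> K. lam a = 0}"

text \<open>On \<open>K\<close> this is the projection onto \<open>K0\<close> along the embedded
  base field; in characteristic two the sum is a difference.\<close>

definition mu :: "'e \<Rightarrow> 'e" where "mu z = z + emb (lam z)"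

lemma mu_add: "mu (x + y) = mu x + mu y"
  by (simp add: mu_def lam_add emb_add)

lemma mu_mult: "mu (emb c * x) = emb c * mu x"
  by (simp add: mu_def lam_mult emb_mult distrib_left)

lemma mu_zero: "mu 0 = 0" by (simp add: mu_def lam_zero emb_zero)

lemma mu_in_K0: "z \<in> K \<Longrightarrow> mu z \<in> K0"
  by (simp add: mu_def K0_def K_add emb_in_K lam_add lam_emb base_add_self)

lemma mu_K0: "a \<in> K0 \<Longrightarrow> mu a = a"
  by (simp add: mu_def K0_def emb_zero)

lemma K0_K: "a \<in> K0 \<Longrightarrow> a \<in> K" and K0_L: "a \<in> K0 \<Longrightarrow> a \<in> L"
  using K_subset_L by (auto simp: K0_def)

lemma K0_zero: "0 \<in> K0" by (simp add: K0_def zero_mem lam_zero)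

lemma K0_add: "a \<in> K0 \<Longrightarrow> b \<in> K0 \<Longrightarrow> a + b \<in> K0"
  by (simp add: K0_def K_add lam_add)

lemma K0_mult: "a \<in> K0 \<Longrightarrow> emb c * a \<in> K0"
  by (simp add: K0_def K_mult emb_in_K lam_mult)

text \<open>\<open>K\<close> is the direct sum of \<open>K0\<close> and the embedded base field,
  with coordinates \<open>mu z\<close> and \<open>lam z\<close>.\<close>

lemma card_K0: "card K0 = q ^ (k - 1)"
proof -
  have "bij_betw (\<lambda>(a, c). a + emb c) (K0 \<times> UNIV) K"
  proof (rule bij_betwI[where g = "\<lambda>z. (mu z, lam z)"])
    show "(\<lambda>(a, c). a + emb c) \<in> K0 \<times> UNIV \<rightarrow> K"
      by (auto simp: K0_K K_add emb_in_K)
    show "(\<lambda>z. (mu z, lam z)) \<in> K \<rightarrow> K0 \<times> UNIV"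
      by (auto simp: mu_in_K0)
    show "(mu ((\<lambda>(a, c). a + emb c) p), lam ((\<lambda>(a, c). a + emb c) p)) = p"
      if "p \<in> K0 \<times> UNIV" for p
      using that by (auto simp: mu_def lam_add lam_emb emb_add K0_def emb_zero add_self add.assoc)
    show "(\<lambda>(a, c). a + emb c) (mu z, lam z) = z" if "z \<in> K" for z
      by (simp add: mu_def add.assoc add_self)
  qed
  then have "card K0 * q = q ^ k"
    by (auto dest!: bij_betw_same_card simp: card_cartesian_product card_K q_card)
  also have "\<dots> = q ^ (k - 1) * q" using k_pos by (cases k) simp_all
  finally show ?thesis using q_gt_1 by simp
qed

section \<open>The quadratic form over K and the symplectic form over F\<close>

definition scl :: "'a \<Rightarrow> 'e \<times> 'e \<times> 'e \<times> 'e \<Rightarrow> 'e \<times> 'e \<times> 'e \<times> 'e" where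
  "scl c = (\<lambda>(x, a, y, b). (emb c * x, emb c * a, emb c * y, emb c * b))"

text \<open>The polar form of \<open>Q\<close>, to which the square \<open>b ^ 2\<close> contributes
  nothing in characteristic two.\<close>

definition beta :: "'e \<times> 'e \<times> 'e \<times> 'e \<Rightarrow> 'e \<times> 'e \<times> 'e \<times> 'e \<Rightarrow> 'e" where
  "beta = (\<lambda>(x, a, y, b) (x', a', y', b'). T (x * y' + x' * y) + a * b' + a' * b)"

definition Q :: "'e \<times> 'e \<times> 'e \<times> 'e \<Rightarrow> 'e" where
  "Q = (\<lambda>(x, a, y, b). T (x * y) + b ^ 2 + a * b)"

definition form :: "'e \<times> 'e \<times> 'e \<times> 'e \<Rightarrow> 'e \<times> 'e \<times> 'e \<times> 'e \<Rightarrow> 'a" where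
  "form u v = lam (beta u v)"

definition M :: "('e \<times> 'e \<times> 'e \<times> 'e) set" where "M = L \<times> K0 \<times> L \<times> K0"

lemma scl_simp [simp]: "scl c (x, a, y, b) = (emb c * x, emb c * a, emb c * y, emb c * b)"
  by (simp add: scl_def)

lemma beta_simp [simp]:
  "beta (x, a, y, b) (x', a', y', b') = T (x * y' + x' * y) + a * b' + a' * b"
  by (simp add: beta_def)

lemma Q_simp [simp]: "Q (x, a, y, b) = T (x * y) + b ^ 2 + a * b"
  by (simp add: Q_def)

lemma vector_space_scl: "vector_space scl"
  by unfold_locales
    (auto simp: algebra_simps emb_add emb_mult emb_one)

sublocale V: vector_space scl by (rule vector_space_scl)

lemma beta_add_left: "beta (u + v) w = beta u w + beta v w"
  by (cases u; cases v; cases w) (simp add: T_add algebra_simps)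

lemma beta_commute: "beta u v = beta v u"
  by (cases u; cases v) (simp add: add_ac)

lemma beta_add_right: "beta w (u + v) = beta w u + beta w v"
  by (metis beta_add_left beta_commute)

lemma beta_zero: "beta 0 u = 0" "beta u 0 = 0"
  by (metis beta_add_left beta_commute add_0 add_cancel_right_right)+

lemma beta_scl_left: "beta (scl c u) v = emb c * beta u v"
  by (cases u; cases v) (simp add: T_mult[OF emb_in_K, symmetric] algebra_simps)

lemma beta_scl_right: "beta u (scl c v) = emb c * beta u v"
  by (metis beta_scl_left beta_commute)

lemma beta_self: "beta u u = 0"
  by (cases u) (simp add: add_self T_zero)

lemma Q_add: "Q (u + v) = Q u + Q v + beta u v"
  by (cases u; cases v) (simp add: T_add algebra_simps power2_eq_square two)

lemma beta_in_K: "u \<in> M \<Longrightarrow> v \<in> M \<Longrightarrow> beta u v \<in> K"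
  by (cases u; cases v) (auto simp: M_def K0_K intro!: K_add K_mult T_in_K L_add L_mult)

lemma Q_in_K: "u \<in> M \<Longrightarrow> Q u \<in> K"
  by (cases u) (auto simp: M_def K0_K power2_eq_square intro!: K_add K_mult T_in_K L_add L_mult)

lemma subspace_M: "V.subspace M"
  by (rule V.subspaceI)
    (auto simp: M_def zero_prod_def zero_mem K0_zero L_add K0_add K0_mult L_mult K_L emb_in_K)

lemma finite_M: "finite M"
  unfolding M_def using finite_KL by (auto simp: K0_def)

text \<open>In the \<open>L\<close> coordinates an inverse detects a nonzero entry, as
  \<open>T 1 = 1\<close> and \<open>lam 1 = 1\<close>. In the other two the inverse may leave
  \<open>K0\<close>, so orthogonality to \<open>K0\<close> is first extended to \<open>K\<close> by
  splitting off the base field part.\<close>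

lemma nondegenerate_M:
  assumes u: "u \<in> M" and orth: "\<And>v. v \<in> M \<Longrightarrow> form u v = 0"
  shows "u = 0"
proof -
  obtain x a y b where uu: "u = (x, a, y, b)" by (cases u)
  have mem: "x \<in> L" "y \<in> L" "a \<in> K0" "b \<in> K0" using u by (auto simp: uu M_def)
  have K0_orth: "z = 0" if z: "z \<in> K0" and o: "\<And>w. w \<in> K0 \<Longrightarrow> lam (z * w) = 0" for z
  proof (rule ccontr)
    assume "z \<noteq> 0"
    have "lam (z * w) = 0" if "w \<in> K" for w
    proof -
      have "z * w = z * mu w + emb (lam w) * z"
        by (simp add: mu_def algebra_simps add_self)
      then show ?thesis
        using o[OF mu_in_K0[OF that]] z by (simp add: lam_add lam_mult K0_def)
    qed
    from this[of "inverse z"] \<open>z \<noteq> 0\<close> z show False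
      by (simp add: K_inverse K0_K lam_one)
  qed
  have "x = 0"
  proof (rule ccontr)
    assume "x \<noteq> 0"
    with orth[of "(0, 0, inverse x, 0)"] mem show False
      by (simp add: uu form_def M_def zero_mem K0_zero L_inverse T_one lam_one)
  qed
  moreover have "y = 0"
  proof (rule ccontr)
    assume "y \<noteq> 0"
    with orth[of "(inverse y, 0, 0, 0)"] mem show False
      by (simp add: uu form_def M_def zero_mem K0_zero L_inverse T_one lam_one)
  qed
  moreover have "a = 0"
  proof (rule K0_orth[OF mem(3)])
    show "lam (a * w) = 0" if "w \<in> K0" for w
      using orth[of "(0, 0, 0, w)"] that by (simp add: uu form_def M_def zero_mem K0_zero T_zero)
  qed
  moreover have "b = 0"
  proof (rule K0_orth[OF mem(4)])
    show "lam (b * w) = 0" if "w \<in> K0" for w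
      using orth[of "(0, w, 0, 0)"] that
      by (simp add: uu form_def M_def zero_mem K0_zero T_zero mult.commute)
  qed
  ultimately show ?thesis by (simp add: uu zero_prod_def)
qed

lemma alternating_subspace_M: "alternating_subspace scl form M"
  by unfold_locales
    (auto simp: subspace_M finite_M form_def beta_add_left beta_add_right beta_scl_left
      beta_scl_right lam_add lam_mult beta_self lam_zero
      intro: nondegenerate_M[unfolded form_def])

section \<open>The members of the partial spread\<close>

text \<open>Without \<open>mu\<close> these vectors are singular for \<open>Q\<close>, since
  \<open>T ((s * x) ^ 2) = T (s * x) ^ 2\<close> and \<open>T (s * a * x) = a * T (s * x)\<close>.
  In these coordinates the centre of projection is \<open>(0, 0, 0, 1)\<close>:
  \<open>a \<in> K0\<close> expresses orthogonality to it, and \<open>mu\<close> reduces the last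
  coordinate modulo it.\<close>

definition member :: "'e \<Rightarrow> ('e \<times> 'e \<times> 'e \<times> 'e) set" where
  "member s = (\<lambda>(x, a). (x, a, s ^ 2 * x + s * a, mu (T (s * x)))) ` (L \<times> K0)"

text \<open>The exceptional member: \<open>x = 0\<close> and \<open>a = b\<close> make
  \<open>Q\<close> vanish.\<close>

definition member_inf :: "('e \<times> 'e \<times> 'e \<times> 'e) set" where
  "member_inf = (\<lambda>(y, b). (0, b, y, b)) ` (L \<times> K0)"

definition family :: "('e \<times> 'e \<times> 'e \<times> 'e) set set" where
  "family = insert member_inf (member ` L)"

lemma mem_member:
  "(x, a, y, b) \<in> member s \<longleftrightarrow>
    x \<in> L \<and> a \<in> K0 \<and> y = s ^ 2 * x + s * a \<and> b = mu (T (s * x))"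
  by (auto simp: member_def)

lemma mem_member_inf: "(x, a, y, b) \<in> member_inf \<longleftrightarrow> x = 0 \<and> a = b \<and> y \<in> L \<and> b \<in> K0"
  by (auto simp: member_inf_def)

lemma subspace_member: "V.subspace (member s)"
proof (rule V.subspaceI)
  show "0 \<in> member s"
    by (simp add: zero_prod_def mem_member zero_mem K0_zero T_zero mu_zero)
  show "u + v \<in> member s" if "u \<in> member s" "v \<in> member s" for u v
    using that
    by (cases u; cases v) (simp add: mem_member L_add K0_add T_add mu_add algebra_simps)
  show "scl c u \<in> member s" if "u \<in> member s" for c u
  proof -
    have "mu (T (s * (emb c * x))) = emb c * mu (T (s * x))" for x
      by (metis T_mult[OF emb_in_K] mu_mult mult.left_commute)
    then show ?thesis using that
      by (cases u) (simp add: mem_member L_mult K_L emb_in_K K0_mult distrib_left mult.left_commute)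
  qed
qed

lemma subspace_member_inf: "V.subspace member_inf"
proof (rule V.subspaceI)
  show "0 \<in> member_inf" by (simp add: zero_prod_def mem_member_inf zero_mem K0_zero)
  show "u + v \<in> member_inf" if "u \<in> member_inf" "v \<in> member_inf" for u v
    using that by (cases u; cases v) (simp add: mem_member_inf L_add K0_add)
  show "scl c u \<in> member_inf" if "u \<in> member_inf" for c u
    using that by (cases u) (simp add: mem_member_inf L_mult K_L emb_in_K K0_mult)
qed

lemma subspace_family: "Z \<in> family \<Longrightarrow> V.subspace Z"
  by (auto simp: family_def subspace_member subspace_member_inf)

lemma family_subset_M: "Z \<in> family \<Longrightarrow> Z \<subseteq> M"
  by (auto simp: family_def member_def member_inf_def M_def power2_eq_square zero_mem K0_L
      intro!: L_add L_mult mu_in_K0 T_in_K)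

text \<open>For \<open>member s\<close> all terms of \<open>beta\<close> cancel except those caused
  by \<open>mu\<close>; these are base field multiples of \<open>a\<close> and \<open>a'\<close>,
  which lie in the kernel of \<open>lam\<close>.\<close>

lemma isotropic_family:
  assumes "Z \<in> family" "u \<in> Z" "v \<in> Z"
  shows "form u v = 0"
proof -
  obtain x a y b where u: "u = (x, a, y, b)" by (cases u)
  obtain x' a' y' b' where v: "v = (x', a', y', b')" by (cases v)
  consider "Z = member_inf" | s where "s \<in> L" "Z = member s"
    using assms(1) by (auto simp: family_def)
  then show ?thesis
  proof cases
    case 1
    then show ?thesis using assms(2,3)
      by (auto simp: u v mem_member_inf form_def T_zero mult.commute add_self lam_zero)
  next
    case 2
    then have uv: "a \<in> K0" "y = s ^ 2 * x + s * a" "b = mu (T (s * x))"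
      "a' \<in> K0" "y' = s ^ 2 * x' + s * a'" "b' = mu (T (s * x'))"
      using assms(2,3) by (auto simp: u v mem_member)
    have "x * y' + x' * y = a' * (s * x) + a * (s * x') + (s ^ 2 * x * x' + s ^ 2 * x * x')"
      by (simp add: uv algebra_simps)
    then have "T (x * y' + x' * y) = a' * T (s * x) + a * T (s * x')"
      by (simp add: add_self T_add T_mult K0_K uv)
    then have "beta u v = a' * T (s * x) + a * T (s * x') + a * mu (T (s * x')) + a' * mu (T (s * x))"
      by (simp add: u v uv)
    also have "\<dots> = emb (lam (T (s * x'))) * a + emb (lam (T (s * x))) * a'
        + (a' * T (s * x) + a' * T (s * x)) + (a * T (s * x') + a * T (s * x'))"
      by (simp add: mu_def algebra_simps)
    also have "\<dots> = emb (lam (T (s * x'))) * a + emb (lam (T (s * x))) * a'"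
      by (simp add: add_self)
    finally show ?thesis
      using uv by (simp add: form_def lam_add lam_mult K0_def)
  qed
qed

lemma exponent: "k * (2 * m - 1) + (k - 1) = 2 * m * k - 1"
  using k_pos m_pos by (cases m; cases k) (simp_all add: algebra_simps)

lemma card_family_member: "Z \<in> family \<Longrightarrow> card Z = q ^ (2 * m * k - 1)"
proof -
  have "card (L \<times> K0) = q ^ (2 * m * k - 1)"
    by (simp only: card_cartesian_product card_L card_K0 exponent flip: power_add)
  moreover have "card (member s) = card (L \<times> K0)" for s
    unfolding member_def by (rule card_image) (auto simp: inj_on_def)
  moreover have "card member_inf = card (L \<times> K0)"
    unfolding member_inf_def by (rule card_image) (auto simp: inj_on_def)
  ultimately show "Z \<in> family \<Longrightarrow> card Z = q ^ (2 * m * k - 1)"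
    by (auto simp: family_def)
qed

lemma card_M: "card M = q ^ (2 * (2 * m * k - 1))"
proof -
  have "card M = (card L * card K0) ^ 2"
    by (simp add: M_def card_cartesian_product power2_eq_square)
  also have "card L * card K0 = q ^ (2 * m * k - 1)"
    by (simp only: card_L card_K0 exponent flip: power_add)
  finally show ?thesis by (simp flip: power_mult add: mult.commute)
qed

text \<open>Equal third coordinates force \<open>(s + t) * x = a\<close>, an element of
  \<open>K0\<close> and so fixed by \<open>T\<close> and \<open>mu\<close>; equal last coordinates
  then say that it is zero.\<close>

lemma member_Int_member:
  assumes st: "s \<noteq> t" and u: "u \<in> member s" "u \<in> member t"
  shows "u = 0"
proof -
  obtain x a y b where uu: "u = (x, a, y, b)" by (cases u)
  have a: "a \<in> K0" and e1: "s ^ 2 * x + s * a = t ^ 2 * x + t * a"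
    and e2: "mu (T (s * x)) = mu (T (t * x))"
    and y: "y = s ^ 2 * x + s * a" and b: "b = mu (T (s * x))"
    using u by (auto simp: uu mem_member)
  have "(s + t) * ((s + t) * x + a) = (s ^ 2 * x + s * a) + (t ^ 2 * x + t * a) + (s * t * x + s * t * x)"
    by (simp add: algebra_simps power2_eq_square)
  then have "(s + t) * ((s + t) * x + a) = 0"
    by (simp add: e1 add_self)
  moreover have "s + t \<noteq> 0" using st by (simp add: add_eq_zero_iff)
  ultimately have xa: "(s + t) * x = a" by (simp add: add_eq_zero_iff)
  have "mu (T ((s + t) * x)) = 0"
    by (simp add: distrib_right T_add mu_add e2 add_self)
  then have "a = 0" using a by (simp add: xa T_K K0_K mu_K0)
  moreover from this have "x = 0" using xa \<open>s + t \<noteq> 0\<close> by simp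
  ultimately show ?thesis by (simp add: uu y b zero_prod_def T_zero mu_zero)
qed

lemma member_Int_member_inf:
  assumes "u \<in> member s" "u \<in> member_inf"
  shows "u = 0"
  using assms by (cases u) (auto simp: mem_member mem_member_inf zero_prod_def T_zero mu_zero)

lemma family_Int:
  assumes "Y \<in> family" "Z \<in> family" "Y \<noteq> Z"
  shows "Y \<inter> Z = {0}"
proof -
  have "u = 0" if u: "u \<in> Y" "u \<in> Z" for u
  proof (cases "Y = member_inf \<or> Z = member_inf")
    case True
    then show ?thesis using assms u member_Int_member_inf[of u] unfolding family_def by blast
  next
    case False
    then obtain s t where "Y = member s" "Z = member t" using assms by (auto simp: family_def)
    then show ?thesis using assms(3) u member_Int_member[of s t u] by auto
  qed
  then show ?thesis using assms V.subspace_0[OF subspace_family] by blast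
qed

lemma card_family: "card family = q ^ (2 * m * k - k) + 1"
proof -
  \<comment> \<open>A vector with first coordinate 1: it is nonzero, which separates the members
    from one another, and it is not in \<open>member_inf\<close>.\<close>
  have nz: "(1, 0, s ^ 2, mu (T s)) \<in> member s" for s
    by (simp add: mem_member zero_mem K0_zero)
  have "inj_on member L"
  proof (rule inj_onI, rule ccontr)
    fix s t assume "member s = member t" "s \<noteq> t"
    then have "(1, 0, s ^ 2, mu (T s)) = (0 :: 'e \<times> 'e \<times> 'e \<times> 'e)"
      using nz by (metis member_Int_member)
    then show False by (simp add: zero_prod_def)
  qed
  moreover have "member_inf \<notin> member ` L"
  proof
    assume "member_inf \<in> member ` L"
    then have "\<exists>s. (1, 0, s ^ 2, mu (T s)) \<in> member_inf" using nz by auto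
    then show False by (simp add: mem_member_inf)
  qed
  moreover have "k * (2 * m - 1) = 2 * m * k - k"
    by (simp add: algebra_simps)
  ultimately show ?thesis
    using finite_KL by (simp add: family_def card_image card_L)
qed

section \<open>Every singular vector of the model is covered\<close>

text \<open>For \<open>x = 0\<close> the equation factors as \<open>b * (b + a) = 0\<close>, which
  leads to \<open>member_inf\<close> or to the slope \<open>y / a\<close>. Otherwise the slope comes
  from counting.\<close>

lemma Q_zero_imp_mem_family:
  assumes u: "u \<in> M" and Q: "Q u = 0"
  shows "\<exists>Z\<in>family. u \<in> Z"
proof -
  obtain x a y b where uu: "u = (x, a, y, b)" by (cases u)
  have mem: "x \<in> L" "y \<in> L" "a \<in> K0" "b \<in> K0" using u by (auto simp: uu M_def)
  have Tb: "T (x * y) = b ^ 2 + a * b"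
    using Q by (simp add: uu add.assoc add_eq_zero_iff)
  show ?thesis
  proof (cases "x = 0")
    case True
    then have "b * (b + a) = 0"
      using Tb by (simp add: T_zero algebra_simps power2_eq_square)
    then consider "a = b" | "b = 0" "a \<noteq> 0" by (auto simp: add_eq_zero_iff)
    then show ?thesis
    proof cases
      case 1
      then have "u \<in> member_inf" using mem True by (simp add: uu mem_member_inf)
      then show ?thesis by (auto simp: family_def)
    next
      case 2
      then have "u \<in> member (y * inverse a)"
        using mem True by (simp add: uu mem_member T_zero mu_zero)
      moreover have "y * inverse a \<in> L" using mem by (simp add: L_mult L_inverse K0_L)
      ultimately show ?thesis by (auto simp: family_def)
    qed
  next
    case False
    txt \<open>The required \<open>s\<close> is \<open>z / x\<close>, where \<open>z\<^sup>2 + z a = x y\<close> and \<open>T z = b\<close>; it exists because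
      the map \<open>f\<close> below is injective between cosets of the kernel of \<open>T\<close>.\<close>
    let ?A = "{z \<in> L. T z = b}" and ?D = "{z \<in> L. T z = b ^ 2 + a * b}"
    define f where "f z = z ^ 2 + z * a" for z
    \<comment> \<open>Translation by an element of \<open>K\<close> changes the trace by that
      element, so \<open>t\<close> matches the two fibres \<open>?A\<close> and \<open>?D\<close>
      and they have equal size.\<close>
    define t where "t = b + (b ^ 2 + a * b)"
    have tK: "t \<in> K" using mem by (auto simp: t_def K0_K power2_eq_square intro!: K_add K_mult)
    have t: "b + t = b ^ 2 + a * b" "b ^ 2 + a * b + t = b"
      by (simp_all add: t_def algebra_simps two)
    have "bij_betw (\<lambda>z. z + t) ?A ?D"
    proof (rule bij_betwI[where g = "\<lambda>z. z + t"])
      show "(\<lambda>z. z + t) \<in> ?A \<rightarrow> ?D" "(\<lambda>z. z + t) \<in> ?D \<rightarrow> ?A"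
        by (rule funcsetI, simp add: L_add K_L tK T_add T_K t)+
    qed (simp_all add: add.assoc add_self)
    then have cAD: "card ?A = card ?D" by (rule bij_betw_same_card)
    have "inj_on f ?A"
    proof (rule inj_onI)
      fix z w assume z: "z \<in> ?A" and w: "w \<in> ?A" and e: "f z = f w"
      have "(z + w) * (z + w + a) = f z + f w + (z * w + z * w)"
        by (simp add: f_def algebra_simps power2_eq_square)
      then have "(z + w) * (z + w + a) = 0" by (simp add: e add_self)
      then consider "z = w" | "z + w = a" by (auto simp: add_eq_zero_iff)
      then show "z = w"
      proof cases
        \<comment> \<open>Here \<open>z + w = a\<close> has trace 0, while \<open>T\<close> fixes
          \<open>a\<close> as an element of \<open>K\<close>.\<close>
        case 2
        have "T (z + w) = 0" using z w by (simp add: T_add add_self)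
        with 2 mem have "z + w = 0" by (simp add: T_K K0_K)
        then show ?thesis by (simp add: add_eq_zero_iff)
      qed
    qed
    moreover have "f ` ?A \<subseteq> ?D"
    proof (rule image_subsetI)
      fix z assume z: "z \<in> ?A"
      have "T (z * a) = a * T z" using mem by (metis T_mult K0_K mult.commute)
      moreover have "f z \<in> L"
        using z mem by (auto simp: f_def power2_eq_square K0_L intro!: L_add L_mult)
      ultimately show "f z \<in> ?D"
        using z by (simp add: f_def T_add T_square)
    qed
    ultimately have "f ` ?A = ?D"
      using cAD finite_KL by (intro card_subset_eq) (auto simp: card_image)
    moreover have "x * y \<in> ?D" using mem Tb by (simp add: L_mult)
    ultimately have "x * y \<in> f ` ?A" by simp
    then obtain z where z: "z \<in> L" "T z = b" "f z = x * y" by auto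
    have "(z * inverse x) ^ 2 * x + z * inverse x * a = f z / x"
      using False by (simp add: f_def divide_inverse algebra_simps power2_eq_square)
    also have "\<dots> = y" using False by (simp add: z(3))
    finally have "y = (z * inverse x) ^ 2 * x + z * inverse x * a" ..
    moreover have "z * inverse x * x = z" using False by simp
    ultimately have "u \<in> member (z * inverse x)"
      using mem z(2) by (simp only: uu mem_member mu_K0)
    moreover have "z * inverse x \<in> L" using mem z by (simp add: L_mult L_inverse)
    ultimately show ?thesis by (auto simp: family_def)
  qed
qed

section \<open>Maximality\<close>

text \<open>Greedy construction: \<open>U\<close> is the span of the vectors chosen so far, and
  \<open>C\<close> a part of \<open>W\<close> orthogonal to it. The next vector \<open>w\<close> is
  taken from \<open>C\<close> outside \<open>U\<close>, and \<open>C\<close> is cut down to the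
  kernel of \<open>beta w\<close>, which costs a factor of at most
  \<open>card K = q ^ k\<close>.\<close>

lemma isotropic_extend:
  assumes W: "V.subspace W" "W \<subseteq> M" and card: "card W \<ge> q ^ N" and N: "k * k + k < N" and j: "j \<le> k + 1"
  shows "\<exists>U C. V.subspace U \<and> V.subspace C \<and> U \<subseteq> C \<and> C \<subseteq> W \<and> card U = q ^ j \<and>
    (\<forall>u\<in>U. \<forall>c\<in>C. beta u c = 0) \<and> card W \<le> card C * q ^ (k * j)"
  using j
proof (induction j)
  case 0
  then show ?case
    using W by (intro exI[of _ "{0}"] exI[of _ W]) (auto simp: V.subspace_0 beta_zero)
next
  case (Suc j)
  then obtain U C where UC: "V.subspace U" "V.subspace C" "U \<subseteq> C" "C \<subseteq> W" "card U = q ^ j"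
    "\<And>u c. u \<in> U \<Longrightarrow> c \<in> C \<Longrightarrow> beta u c = 0" and cW: "card W \<le> card C * q ^ (k * j)"
    by (metis Suc_leD)
  have fin: "finite C" "finite U"
    using UC W finite_M by (meson finite_subset subset_trans)+
  \<comment> \<open>Otherwise \<open>q ^ N \<le> q ^ (j + k * j)\<close> with
    \<open>j \<le> k\<close>, contrary to \<open>k * k + k < N\<close>.\<close>
  have "\<not> C \<subseteq> U"
  proof
    assume "C \<subseteq> U"
    then have "card C \<le> q ^ j" using UC fin by (metis card_mono)
    then have "card C * q ^ (k * j) \<le> q ^ j * q ^ (k * j)" by (rule mult_le_mono1)
    then have "q ^ N \<le> q ^ (j + k * j)"
      unfolding power_add using card cW by linarith
    then have "N \<le> j + k * j" using q_gt_1 by simp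
    moreover have "k * j \<le> k * k" using Suc.prems by (intro mult_le_mono2) simp
    ultimately show False using N Suc.prems by simp
  qed
  then obtain w where w: "w \<in> C" "w \<notin> U" by blast
  let ?g = "\<lambda>(c, u). scl c w + u"
  let ?U = "?g ` (UNIV \<times> U)"
  let ?C = "{c \<in> C. beta w c = 0}"
  have U': "?U = {x + y |x y. x \<in> V.span {w} \<and> y \<in> U}"
    unfolding V.span_singleton by (force simp del: split_paired_Ex split_paired_All)
  have "V.subspace ?U"
    unfolding U' by (rule V.subspace_sums[OF V.subspace_span UC(1)])
  moreover have "V.subspace ?C"
    using UC(2) by (auto simp: V.subspace_def beta_add_right beta_scl_right beta_zero)
  moreover have "?U \<subseteq> ?C"
  proof (rule image_subsetI)
    fix p assume "p \<in> (UNIV :: 'a set) \<times> U"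
    then obtain c u where p: "p = (c, u)" and u: "u \<in> U" by blast
    have "beta w u = 0" using UC(6)[OF u w(1)] by (simp add: beta_commute)
    then show "?g p \<in> ?C"
      using UC u w by (auto simp: p beta_add_right beta_scl_right beta_self intro!: V.subspace_add V.subspace_scale)
  qed
  moreover have "?C \<subseteq> W" using UC by auto
  moreover have "card ?U = q ^ Suc j"
  proof -
    have "inj_on ?g (UNIV \<times> U)"
    proof (rule inj_onI, clarify)
      fix c d u v assume uv: "u \<in> U" "v \<in> U" and e: "scl c w + u = scl d w + v"
      have "scl (c - d) w = v - u"
        using e by (simp add: V.scale_left_diff_distrib algebra_simps)
      then have mem: "scl (c - d) w \<in> U" using uv UC(1) by (simp add: V.subspace_diff)
      have "c = d"
      proof (rule ccontr)
        assume "c \<noteq> d"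
        then have "w = scl (inverse (c - d)) (scl (c - d) w)"
          by (simp only: V.scale_scale) simp
        then show False using V.subspace_scale[OF UC(1) mem] w(2) by metis
      qed
      then show "c = d \<and> u = v" using e by simp
    qed
    then show ?thesis by (simp add: card_image card_cartesian_product UC q_card)
  qed
  moreover have "beta x c = 0" if x: "x \<in> ?U" and c: "c \<in> ?C" for x c
  proof -
    obtain p where "x = ?g p" "p \<in> (UNIV :: 'a set) \<times> U" using x by (rule imageE)
    then obtain d u where "x = scl d w + u" "u \<in> U" by force
    moreover from this c have "beta u c = 0" using UC(6) by blast
    ultimately show ?thesis using c by (simp add: beta_add_left beta_scl_left)
  qed
  moreover have "card W \<le> card ?C * q ^ (k * Suc j)"
  proof -
    have "card C \<le> card ?C * card K"
    proof (rule card_le_card_kernel_times)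
      show "x - y \<in> C" if "x \<in> C" "y \<in> C" for x y using that UC(2) by (simp add: V.subspace_diff)
      show "beta w ` C \<subseteq> K" using UC W w by (auto intro!: beta_in_K)
      show "beta w (x - y) = beta w x - beta w y" for x y
        using beta_add_right[of w "x - y" y] by simp
    qed (use fin finite_KL in auto)
    then have "card C * q ^ (k * j) \<le> (card ?C * q ^ k) * q ^ (k * j)"
      unfolding card_K by (rule mult_le_mono1)
    with cW have "card W \<le> (card ?C * q ^ k) * q ^ (k * j)" by (rule le_trans)
    then show ?thesis by (simp add: power_add mult.assoc)
  qed
  ultimately show ?case by blast
qed

lemma meets_family:
  assumes W: "V.subspace W" "W \<subseteq> M" and card: "card W \<ge> q ^ N" and N: "k * k + k < N"
  shows "\<exists>Z\<in>family. \<exists>u\<in>W \<inter> Z. u \<noteq> 0"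
proof -
  obtain U C where UC: "V.subspace U" "U \<subseteq> C" "C \<subseteq> W" "card U = q ^ (k + 1)"
    "\<And>u c. u \<in> U \<Longrightarrow> c \<in> C \<Longrightarrow> beta u c = 0"
    using isotropic_extend[OF W card N order_refl] by blast
  have UM: "U \<subseteq> M" using UC W by auto
  \<comment> \<open>\<open>U\<close> has \<open>q ^ (k + 1)\<close> vectors, but \<open>Q\<close>
    takes at most \<open>q ^ k\<close> values on them.\<close>
  have "\<not> inj_on Q U"
  proof
    assume "inj_on Q U"
    then have "card U \<le> card K"
      using Q_in_K UM finite_KL by (intro card_inj_on_le[of Q]) auto
    then show False using UC(4) q_gt_1 by (simp add: card_K)
  qed
  then obtain u v where uv: "u \<in> U" "v \<in> U" "Q u = Q v" "u \<noteq> v" unfolding inj_on_def by blast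
  have uvU: "u - v \<in> U" using uv UC by (simp add: V.subspace_diff)
  \<comment> \<open>As \<open>beta\<close> vanishes on \<open>U\<close>, the difference of two
    vectors with the same value of \<open>Q\<close> is singular.\<close>
  have "beta (u - v) v = 0" using UC(2,5) uvU uv by blast
  then have "Q (u - v) + Q v = Q u" using Q_add[of "u - v" v] by simp
  then have "Q (u - v) = 0" using uv by simp
  then obtain Z where "Z \<in> family" "u - v \<in> Z"
    using Q_zero_imp_mem_family uvU UM by blast
  then show ?thesis using uvU UC uv by (intro bexI[of _ Z] bexI[of _ "u - v"]) auto
qed

end

section \<open>Realisation of the tower in an algebraic closure\<close>

lemma CHAR_eq_2:
  assumes "(2::'a::idom) = 0"
  shows "CHAR('a) = 2"
proof -
  have "CHAR('a) dvd 2" using assms by (simp flip: of_nat_eq_0_iff_char_dvd)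
  then show ?thesis using CHAR_not_1'[where 'a = 'a] two_is_prime_nat by (auto simp: prime_nat_iff)
qed

text \<open>The closure is a vector space over its base field, and the independent set
  \<open>{1}\<close> allows the value at 1 to be prescribed.\<close>

lemma exists_linear_functional:
  "\<exists>lam :: 'a::field alg_closure \<Rightarrow> 'a.
     (\<forall>x y. lam (x + y) = lam x + lam y) \<and> (\<forall>c x. lam (to_ac c * x) = c * lam x) \<and> lam 1 = 1"
proof -
  interpret vector_space_pair "\<lambda>c (z :: 'a alg_closure). to_ac c * z" "(*) :: 'a \<Rightarrow> 'a \<Rightarrow> 'a"
    by unfold_locales (auto simp: algebra_simps)
  have "vs1.independent {1 :: 'a alg_closure}" by simp
  then obtain g where "Vector_Spaces.linear (\<lambda>c (z :: 'a alg_closure). to_ac c * z) (*) g" "g 1 = 1"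
    using linear_independent_extend[of "{1}" "\<lambda>_. 1"] by auto
  then show ?thesis by (intro exI[of _ g]) (auto simp: Vector_Spaces.linear_iff)
qed

text \<open>\<open>K\<close> and \<open>L\<close> are fixed point sets of Frobenius powers, hence
  fields; their orders come from the separability count.\<close>

lemma exists_field_tower:
  fixes q k m :: nat
  assumes q: "q = card (UNIV :: 'a::{field,finite} set)" and ev: "even q" and k: "k > 0" and m: "m > 0"
  shows "\<exists>L K T lam. field_tower (to_ac :: 'a \<Rightarrow> 'a alg_closure) L K T lam q k m"
proof -
  have two: "(2::'a) = 0" using even_card_imp_two_eq_zero ev q by blast
  then have two': "(2::'a alg_closure) = 0" by (metis to_ac_numeral to_ac_0)
  have "(x::'a) + x = 0" for x using two by (metis mult_2 mult_zero_left)
  then obtain e where e: "q = 2 ^ e" using card_power_of_2[where 'a = 'a] q by auto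
  have e0: "e > 0" using ev e by (cases e) auto
  have CH: "CHAR('a alg_closure) = 2" "CHAR('a) = 2"
    by (rule CHAR_eq_2[OF two'], rule CHAR_eq_2[OF two])
  \<comment> \<open>Here \<open>Q\<close> is the order of \<open>K\<close>, not the quadratic form,
    and \<open>d\<close> is the degree of \<open>L\<close> over \<open>K\<close>.\<close>
  define Q where "Q = q ^ k"
  define d where "d = 2 * m - 1"
  define K where "K = {z :: 'a alg_closure. z ^ Q = z}"
  define L where "L = {z :: 'a alg_closure. z ^ (Q ^ d) = z}"
  \<comment> \<open>The trace as a sum of conjugates, an expression that makes sense on the whole
    closure.\<close>
  define T where "T z = (\<Sum>i<d. z ^ (Q ^ i))" for z :: "'a alg_closure"
  obtain lam :: "'a alg_closure \<Rightarrow> 'a" where lam: "\<And>x y. lam (x + y) = lam x + lam y"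
    "\<And>c x. lam (to_ac c * x) = c * lam x" "lam 1 = 1"
    using exists_linear_functional by blast
  have Q2: "Q ^ i = 2 ^ (e * k * i)" for i
    by (simp add: Q_def e power_mult)
  have frob: "(x + y) ^ (Q ^ i) = x ^ (Q ^ i) + y ^ (Q ^ i)" for x y :: "'a alg_closure" and i
    by (rule freshmans_dream') (simp_all add: CH Q2)
  have K_pow: "z ^ (Q ^ i) = z" if "z \<in> K" for z i
    using that by (induction i) (simp_all add: K_def power_mult)
  have to_ac_q: "to_ac c ^ (q ^ i) = to_ac c" for c :: 'a and i
  proof (induction i)
    case (Suc i)
    have "to_ac c ^ q = to_ac c" by (metis finite_field_power_card q to_ac_power)
    then show ?case using Suc by (simp add: power_mult)
  qed simp
  have "field_tower to_ac L K T lam q k m"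
  proof
    show "to_ac c \<in> K" for c :: 'a by (simp add: K_def Q_def to_ac_q)
    show "x + y \<in> L" if "x \<in> L" "y \<in> L" for x y
      using that by (simp add: L_def frob)
    show "x * y \<in> L" if "x \<in> L" "y \<in> L" for x y
      using that by (simp add: L_def power_mult_distrib)
    show "inverse x \<in> L" if "x \<in> L" for x
      using that by (simp add: L_def power_inverse)
    show "x + y \<in> K" if "x \<in> K" "y \<in> K" for x y
      using that frob[of x y 1] by (simp add: K_def)
    show "x * y \<in> K" if "x \<in> K" "y \<in> K" for x y
      using that by (simp add: K_def power_mult_distrib)
    show "inverse x \<in> K" if "x \<in> K" for x
      using that by (simp add: K_def power_inverse)
    show "K \<subseteq> L" using K_pow by (auto simp: L_def)
    show "card K = q ^ k"
      unfolding K_def using card_roots_X_power_diff_X[OF CH(1), of Q "e * k"] Q2[of 1] e0 k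
      by (simp add: Q_def)
    show "card L = q ^ (k * (2 * m - 1))"
      unfolding L_def using card_roots_X_power_diff_X[OF CH(1) Q2[of d]] e0 k m
      by (simp add: Q_def d_def power_mult)
    show "T (x + y) = T x + T y" for x y
      by (simp add: T_def frob sum.distrib)
    show "T (z * x) = z * T x" if "z \<in> K" for z x
      using K_pow[OF that] by (simp add: T_def power_mult_distrib sum_distrib_left)
    show "T (x ^ 2) = T x ^ 2" for x
    proof -
      have "T x ^ 2 = (\<Sum>i<d. (x ^ (Q ^ i)) ^ 2)"
        unfolding T_def by (rule freshmans_dream_sum) (simp_all add: CH)
      then show ?thesis by (simp add: T_def mult.commute flip: power_mult)
    qed
    show "T x \<in> K" if x: "x \<in> L" for x
    proof -
      \<comment> \<open>The power \<open>Q\<close> shifts the summands by one place; the end terms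
        \<open>x\<close> and \<open>x ^ (Q ^ d)\<close> agree for \<open>x \<in> L\<close>.\<close>
      have "T x ^ Q = (\<Sum>i<d. (x ^ (Q ^ i)) ^ Q)"
        unfolding T_def by (rule freshmans_dream_sum'[where n = "e * k"]) (use Q2[of 1] in \<open>simp_all add: CH\<close>)
      also have "\<dots> = (\<Sum>i<d. x ^ (Q ^ Suc i))"
        by (simp add: mult.commute flip: power_mult)
      finally have "T x ^ Q + x = T x + x ^ (Q ^ d)"
        using sum.lessThan_Suc_shift[of "\<lambda>i. x ^ (Q ^ i)" d] by (simp add: T_def add.commute)
      then show ?thesis using x by (simp add: K_def L_def)
    qed
    show "T 1 = 1"
    proof -
      \<comment> \<open>An odd number of ones adds up to 1 in characteristic two.\<close>
      have "d = 2 * (m - 1) + 1" using m by (simp add: d_def)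
      then have "T 1 = of_nat (2 * (m - 1) + 1)" by (simp add: T_def)
      then show ?thesis by (simp add: two')
    qed
  qed (use two' lam q k m in auto)
  then show ?thesis by blast
qed

section \<open>The theorem in an arbitrary symplectic space\<close>

theorem theorem6p3:
  fixes scale :: "'a::{field,finite} \<Rightarrow> 'b::ab_group_add \<Rightarrow> 'b"
    and form :: "'b \<Rightarrow> 'b \<Rightarrow> 'a"
    and q m k :: nat
  assumes "q = card (UNIV :: 'a set)"
    and "even q"
    and "m > 0"
    and "k > 0"
    and "real m > (real k + 1) / 2"
    and "symplectic_space scale form"
    and "vector_space.dim scale (UNIV :: 'b set) = 4 * m * k - 2"
  shows "\<exists>S. symplectic_space.maximal_symplectic_partial_spread scale form S \<and>
             card S = q ^ (2 * m * k - k) + 1"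
proof -
  interpret symplectic_space scale form by fact
  have lin: "form (x + y) z = form x z + form y z" "form z (x + y) = form z x + form z y"
    "form (scale c x) z = c * form x z" "form z (scale c x) = c * form z x" for x y z c
    using form_linear_left[of z] form_linear_right[of z] unfolding Vector_Spaces.linear_iff by blast+
  obtain C where C: "finite C" "span C = UNIV" using finite_dim by blast
  have fin_sub: "finite W" "card W = q ^ dim W" if "subspace W" for W
    using card_subspace[OF finite that _ C(1)] C(2) assms(1) by auto
  have alt: "alternating_subspace scale form UNIV"
    by unfold_locales (auto simp: lin form_alternating fin_sub intro: form_nondegenerate)
  obtain L K T lam where "field_tower (to_ac :: 'a \<Rightarrow> 'a alg_closure) L K T lam q k m"
    using exists_field_tower[OF assms(1,2,4,3)] by blast
  then interpret F: field_tower "to_ac :: 'a \<Rightarrow> 'a alg_closure" L K T lam q k m .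
  define n where "n = 2 * m * k - 1"
  have dimU: "dim (UNIV :: 'b set) = 2 * n" using assms(7) by (simp add: n_def)
  \<comment> \<open>The dimension hypothesis enters as equality of cardinalities, which makes the
    given space isometric to the model.\<close>
  have "card F.M = card (UNIV :: 'b set)"
    using fin_sub(2)[OF subspace_UNIV] dimU F.card_M by (simp add: n_def)
  from isometry_exists[OF F.alternating_subspace_M alt this]
  obtain \<phi> where bij: "bij_betw \<phi> F.M UNIV"
    and add: "\<And>x y. x \<in> F.M \<Longrightarrow> y \<in> F.M \<Longrightarrow> \<phi> (x + y) = \<phi> x + \<phi> y"
    and scl: "\<And>c x. x \<in> F.M \<Longrightarrow> \<phi> (F.scl c x) = scale c (\<phi> x)"
    and iso: "\<And>x y. x \<in> F.M \<Longrightarrow> y \<in> F.M \<Longrightarrow> form (\<phi> x) (\<phi> y) = F.form x y"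
    by blast
  have inj: "inj_on \<phi> F.M" and surj: "\<phi> ` F.M = UNIV" using bij by (auto simp: bij_betw_def)
  have zero_M: "0 \<in> F.M" using F.subspace_M by (rule F.V.subspace_0)
  have zero: "\<phi> 0 = 0" using add[OF zero_M zero_M] by simp
  have Z_sub: "subspace (\<phi> ` Z)" if Z: "Z \<in> F.family" for Z
  proof (rule subspaceI)
    note ZM = F.family_subset_M[OF Z] and sZ = F.subspace_family[OF Z]
    show "0 \<in> \<phi> ` Z" using zero F.V.subspace_0[OF sZ] by force
    show "x + y \<in> \<phi> ` Z" if "x \<in> \<phi> ` Z" "y \<in> \<phi> ` Z" for x y
    proof -
      obtain u v where "x = \<phi> u" "y = \<phi> v" "u \<in> Z" "v \<in> Z" using \<open>x \<in> \<phi> ` Z\<close> \<open>y \<in> \<phi> ` Z\<close> by blast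
      then show ?thesis using ZM add[of u v] F.V.subspace_add[OF sZ, of u v] by (metis image_eqI subsetD)
    qed
    show "scale c x \<in> \<phi> ` Z" if "x \<in> \<phi> ` Z" for c x
    proof -
      obtain u where "x = \<phi> u" "u \<in> Z" using \<open>x \<in> \<phi> ` Z\<close> by blast
      then show ?thesis using ZM scl[of u c] F.V.subspace_scale[OF sZ, of u c] by (metis image_eqI subsetD)
    qed
  qed
  have Z_card: "card (\<phi> ` Z) = q ^ n" if Z: "Z \<in> F.family" for Z
    using F.card_family_member[OF Z] inj_on_subset[OF inj F.family_subset_M[OF Z]]
    by (simp add: card_image n_def)
  define S where "S = (`) \<phi> ` F.family"
  have spread: "symplectic_partial_spread S"
    unfolding symplectic_partial_spread_def
  proof (intro conjI ballI impI)
    fix A assume "A \<in> S"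
    then obtain Z where Z: "Z \<in> F.family" and A: "A = \<phi> ` Z" by (auto simp: S_def)
    show "subspace A" using Z_sub[OF Z] by (simp add: A)
    have "q ^ dim A = q ^ n" using fin_sub(2)[OF Z_sub[OF Z]] Z_card[OF Z] by (simp add: A)
    then show "2 * dim A = dim (UNIV :: 'b set)" using F.q_gt_1 dimU by simp
    show "totally_isotropic A"
      unfolding totally_isotropic_def A
    proof clarify
      fix u v assume uv: "u \<in> Z" "v \<in> Z"
      then have "u \<in> F.M" "v \<in> F.M" using F.family_subset_M[OF Z] by auto
      then show "form (\<phi> u) (\<phi> v) = 0"
        using iso F.isotropic_family[OF Z uv] by simp
    qed
  next
    fix A B assume "A \<in> S" "B \<in> S" "A \<noteq> B"
    then obtain Z Z' where Z: "Z \<in> F.family" "Z' \<in> F.family" "Z \<noteq> Z'" "A = \<phi> ` Z" "B = \<phi> ` Z'"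
      by (auto simp: S_def)
    then show "A \<inter> B = {0}"
      using inj_on_image_Int[OF inj F.family_subset_M[OF Z(1)] F.family_subset_M[OF Z(2)]]
        F.family_Int[OF Z(1-3)] zero by simp
  qed
  \<comment> \<open>The bound on \<open>m\<close> says \<open>k + 2 \<le> 2 * m\<close>, hence
    \<open>n \<ge> k * k + 2 * k - 1\<close>. This exceeds \<open>k * k + k\<close> when
    \<open>k \<ge> 2\<close>; for \<open>k = 1\<close> it gives only equality, but then
    \<open>2 * m \<ge> 3\<close> forces \<open>m \<ge> 2\<close>.\<close>
  have "k * k + k < n"
  proof -
    have "real (k + 1) < real (2 * m)" using assms(5) by simp
    then have "k + 2 \<le> 2 * m" unfolding of_nat_less_iff by simp
    then have "(k + 2) * k \<le> 2 * m * k" by (rule mult_le_mono1)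
    then have le: "k * k + 2 * k \<le> 2 * m * k" by (simp add: algebra_simps)
    show ?thesis
    proof (cases "k = 1")
      case True
      then have "2 \<le> m" using \<open>k + 2 \<le> 2 * m\<close> by presburger
      then show ?thesis using True by (simp add: n_def)
    next
      case False
      then show ?thesis using le assms(4) by (simp add: n_def)
    qed
  qed
  \<comment> \<open>Here \<open>T\<close> is a partial spread containing \<open>S\<close>. The
    preimage of a further member \<open>A\<close> shares a nonzero vector with some \<open>Z\<close>
    of the family, so \<open>A\<close> and the image of \<open>Z\<close> would be distinct members
    of \<open>T\<close> that meet nontrivially.\<close>
  have no_extension: "A \<in> S" if T: "symplectic_partial_spread T" "S \<subseteq> T" "A \<in> T" for T A
  proof (rule ccontr)
    assume "A \<notin> S"
    have A: "subspace A" "2 * dim A = dim (UNIV :: 'b set)"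
      using T by (auto simp: symplectic_partial_spread_def)
    let ?W = "{u \<in> F.M. \<phi> u \<in> A}"
    have W: "F.V.subspace ?W"
      using F.subspace_M A(1) unfolding F.V.subspace_def subspace_def
      by (auto simp: zero add scl simp del: split_paired_All)
    have cW: "card ?W = q ^ n"
    proof -
      have im: "\<phi> ` ?W = A"
      proof (intro equalityI subsetI)
        fix a assume "a \<in> A"
        moreover have "a \<in> \<phi> ` F.M" by (simp add: surj)
        then obtain u where "u \<in> F.M" "a = \<phi> u" by (rule imageE)
        ultimately show "a \<in> \<phi> ` ?W" by blast
      qed blast
      have "inj_on \<phi> ?W" by (rule inj_on_subset[OF inj]) auto
      from card_image[OF this] have "card ?W = card A" unfolding im ..
      then show ?thesis using fin_sub(2)[OF A(1)] A(2) dimU by simp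
    qed
    obtain Z u where Z: "Z \<in> F.family" and u: "u \<in> F.M" "\<phi> u \<in> A" "u \<in> Z" "u \<noteq> 0"
      using F.meets_family[OF W _ eq_imp_le[OF cW[symmetric]] \<open>k * k + k < n\<close>] by blast
    have "\<phi> u \<noteq> 0" using u inj_onD[OF inj _ u(1) zero_M] zero by auto
    have int: "U \<inter> V = {0}" if "U \<in> T" "V \<in> T" "U \<noteq> V" for U V
      using T(1) that by (simp add: symplectic_partial_spread_def)
    have ZS: "\<phi> ` Z \<in> S" using Z by (simp add: S_def)
    then have "\<phi> ` Z \<in> T" "A \<noteq> \<phi> ` Z" using T(2) \<open>A \<notin> S\<close> by auto
    from int[OF T(3) this] have "A \<inter> \<phi> ` Z = {0}" .
    moreover have "\<phi> u \<in> A \<inter> \<phi> ` Z" using u by simp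
    ultimately show False using \<open>\<phi> u \<noteq> 0\<close> by simp
  qed
  \<comment> \<open>Taking images is injective on subsets of the model, so distinct members stay
    distinct.\<close>
  have "card S = card F.family"
    unfolding S_def
    by (rule card_image, rule inj_on_subset[OF inj_on_image_Pow[OF inj]])
      (use F.family_subset_M in blast)
  then show ?thesis
    using spread no_extension F.card_family
    by (intro exI[of _ S]) (auto simp: maximal_symplectic_partial_spread_def)
qed

end
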